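(* Let $V$ be a variety of universal algebras and let $F$ be the free algebra of $V$ freely generated by $X=\{x_1,\dots,x_n\}$. Let $\Phi$ be a quasi-inner automorphism of $\mathrm{End}(F)$ with $\Phi(\gamma)=\gamma$ for all $\gamma\in P$, and let its main permutation $s$ satisfy $s(x)=x$ for all $x\in X$. Let $\omega$ be a $k$-ary polynomial operation of $F$, $k\le n$, and let $\omega^*$ be the derived operation. Then the main permutation $s$ is an isomorphism between $\omega$ and $\omega^*$, that is, $$s(\omega(a_1,\dots,a_k))=\omega^*(s(a_1),\dots,s(a_k))\quad\text{for all } a_1,\dots,a_k\in F.$$
   Context: $\mathrm{End}(F)$ is the semigroup of all endomorphisms of $F$ under composition. An automorphism $\Phi$ of $\mathrm{End}(F)$ is quasi-inner if there is a bijection $t$ of the set $F$ with $\Phi(\nu)=t\circ\nu\circ t^{-1}$ for all $\nu\in\mathrm{End}(F)$. $P$ is the group of automorphisms $\gamma$ of $F$ with $\gamma(X)=X$. For $a\in F$, $\nu_a$ is the endomorphism of $F$ with $\nu_a(x)=a$ for every $x\in X$. If $\Phi$ preserves $P$ (i.e. $\Phi(P)=P$), the main permutation corresponding to $\Phi$ is the permutation $s$ of $F$ given by $s(a)=\Phi(\nu_a)(x)$ (the right-hand side does not depend on $x\in X$); it satisfies $\Phi(\mu)=s\circ\mu\circ s^{-1}$ for every endomorphism $\mu$. For $a_1,\dots,a_n\in F$, $\alpha_{a_1,\dots,a_n}$ is the endomorphism of $F$ with $x_i\mapsto a_i$, $i=1,\dots,n$. A polynomial operation is an operation on $F$ defined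 by a term in the operations of $V$. For a $k$-ary polynomial operation $\omega$ ($k\le n$), the derived operation $\omega^*$ is defined by $$\omega^*(a_1,\dots,a_k)=\alpha_{a_1,\dots,a_k,x_{k+1},\dots,x_n}\bigl(s(\omega(x_1,\dots,x_k))\bigr).$$ *)

theory Defs
  imports "HOL-Algebra.Group"
begin

section \<open>Signatures, terms, algebras\<close>

text \<open>A signature assigns an arity to each operation symbol; \<open>None\<close> means that the element of
  \<open>'f\<close> is not a symbol of the signature (so the empty signature is covered).\<close>

type_synonym 'f signature = "'f \<rightharpoonup> nat"

datatype ('f, 'v) trm = Var 'v | App 'f "('f, 'v) trm list"

fun wf_trm :: "'f signature \<Rightarrow> 'v set \<Rightarrow> ('f, 'v) trm \<Rightarrow> bool" where
  "wf_trm sg V (Var v) \<longleftrightarrow> v \<in> V"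
| "wf_trm sg V (App f ts) \<longleftrightarrow> sg f = Some (length ts) \<and> (\<forall>t\<in>set ts. wf_trm sg V t)"

record ('f, 'a) ualg = "'a partial_object" +
  interp :: "'f \<Rightarrow> 'a list \<Rightarrow> 'a"

fun eval :: "('f, 'a) ualg \<Rightarrow> ('v \<Rightarrow> 'a) \<Rightarrow> ('f, 'v) trm \<Rightarrow> 'a" where
  "eval A \<rho> (Var v) = \<rho> v"
| "eval A \<rho> (App f ts) = interp A f (map (eval A \<rho>) ts)"

definition subuniverse :: "'f signature \<Rightarrow> ('f, 'a) ualg \<Rightarrow> 'a set \<Rightarrow> bool" where
  "subuniverse sg A S \<longleftrightarrow> S \<subseteq> carrier A \<and>
     (\<forall>f as. sg f = Some (length as) \<and> set as \<subseteq> S \<longrightarrow> interp A f as \<in> S)"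

definition algebra :: "'f signature \<Rightarrow> ('f, 'a) ualg \<Rightarrow> bool" where
  "algebra sg A \<longleftrightarrow> subuniverse sg A (carrier A)"

definition generates :: "'f signature \<Rightarrow> ('f, 'a) ualg \<Rightarrow> 'a set \<Rightarrow> bool" where
  "generates sg A X \<longleftrightarrow> X \<subseteq> carrier A \<and>
     (\<forall>S. subuniverse sg A S \<and> X \<subseteq> S \<longrightarrow> S = carrier A)"

text \<open>Homomorphisms are extensional functions, so that equality of homomorphisms is equality
  on the carrier.\<close>

definition alg_hom :: "'f signature \<Rightarrow> ('f, 'a) ualg \<Rightarrow> ('f, 'b) ualg \<Rightarrow> ('a \<Rightarrow> 'b) set" where
  "alg_hom sg A B = {h \<in> carrier A \<rightarrow>\<^sub>E carrier B.
     \<forall>f as. sg f = Some (length as) \<and> set as \<subseteq> carrier A \<longrightarrow>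
       h (interp A f as) = interp B f (map h as)}"


section \<open>Varieties and free algebras\<close>

text \<open>A variety is given by a set of identities in countably many variables.\<close>

type_synonym 'f identities = "(('f, nat) trm \<times> ('f, nat) trm) set"

definition wf_identities :: "'f signature \<Rightarrow> 'f identities \<Rightarrow> bool" where
  "wf_identities sg E \<longleftrightarrow> (\<forall>(p, q)\<in>E. wf_trm sg UNIV p \<and> wf_trm sg UNIV q)"

definition in_variety :: "'f signature \<Rightarrow> 'f identities \<Rightarrow> ('f, 'a) ualg \<Rightarrow> bool" where
  "in_variety sg E A \<longleftrightarrow> algebra sg A \<and>
     (\<forall>(p, q)\<in>E. \<forall>\<rho>. range \<rho> \<subseteq> carrier A \<longrightarrow> eval A \<rho> p = eval A \<rho> q)"

text \<open>A formula cannot quantify over types, so the universal property is stated for test algebras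
  whose elements are sets of terms with variables in \<open>'a\<close>. This is no restriction: a map from \<open>X\<close>
  to an algebra lands in the subalgebra generated by its image, each element of which can be coded
  by the set of terms over \<open>X\<close> that evaluate to it. Lemma \<open>free_algebra_extension\<close> derives
  the property for test algebras over an arbitrary type.\<close>

definition free_algebra ::
    "'f signature \<Rightarrow> 'f identities \<Rightarrow> ('f, 'a) ualg \<Rightarrow> 'a set \<Rightarrow> bool" where
  "free_algebra sg E A X \<longleftrightarrow> in_variety sg E A \<and> generates sg A X \<and>
     (\<forall>B :: ('f, ('f, 'a) trm set) ualg. in_variety sg E B \<longrightarrow>
        (\<forall>\<phi> \<in> X \<rightarrow> carrier B. \<exists>h \<in> alg_hom sg A B. \<forall>x\<in>X. h x = \<phi> x))"

lemma eval_closed: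
  assumes "algebra sg A" "wf_trm sg V t" "\<And>v. v \<in> V \<Longrightarrow> \<rho> v \<in> carrier A"
  shows "eval A \<rho> t \<in> carrier A"
  using assms(2)
proof (induction t)
  case (App f ts)
  then have wf: "sg f = Some (length ts)" "\<And>t. t \<in> set ts \<Longrightarrow> wf_trm sg V t" by simp_all
  have "set (map (eval A \<rho>) ts) \<subseteq> carrier A"
    using App.IH wf(2) by auto
  moreover have "sg f = Some (length (map (eval A \<rho>) ts))" using wf(1) by simp
  ultimately show ?case
    using assms(1) unfolding algebra_def subuniverse_def by (metis eval.simps(2))
qed (simp add: assms(3))

lemma eval_hom:
  assumes "algebra sg A" "wf_trm sg V t" "\<And>v. v \<in> V \<Longrightarrow> \<rho> v \<in> carrier A"
    and hom: "\<And>f as. sg f = Some (length as) \<Longrightarrow> set as \<subseteq> carrier A \<Longrightarrow>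
       h (interp A f as) = interp B f (map h as)"
  shows "h (eval A \<rho> t) = eval B (h \<circ> \<rho>) t"
  using assms(2)
proof (induction t)
  case (App f ts)
  have "set (map (eval A \<rho>) ts) \<subseteq> carrier A"
    using App.prems eval_closed[where \<rho> = \<rho> and V = V, OF assms(1) _ assms(3)] by auto
  moreover have "map h (map (eval A \<rho>) ts) = map (eval B (h \<circ> \<rho>)) ts"
    using App by (simp add: comp_def)
  moreover have "sg f = Some (length (map (eval A \<rho>) ts))" using App.prems by simp
  ultimately show ?case
    using hom[of f "map (eval A \<rho>) ts"] by (simp only: eval.simps)
qed simp

lemma free_algebra_extension:
  fixes A :: "('f, 'a) ualg" and B :: "('f, 'c) ualg"
  assumes free: "free_algebra sg E A X" and wfE: "wf_identities sg E"
    and B: "in_variety sg E B" and \<phi>: "\<phi> \<in> X \<rightarrow> carrier B"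
  shows "\<exists>h \<in> alg_hom sg A B. \<forall>x\<in>X. h x = \<phi> x"
proof -
  have algB: "algebra sg B" using B by (simp add: in_variety_def)
  define T where "T = {t :: ('f, 'a) trm. wf_trm sg X t}"
  define G where "G = eval B \<phi> ` T"
  define code where "code c = {t \<in> T. eval B \<phi> t = c}" for c
  define dec where "dec S = eval B \<phi> (SOME t. t \<in> S)" for S
  have dec_code: "dec (code c) = c" if c: "c \<in> G" for c
  proof -
    have "\<exists>t. t \<in> code c" using c by (auto simp: G_def code_def)
    then have "(SOME t. t \<in> code c) \<in> code c" by (rule someI_ex)
    then show ?thesis by (simp add: dec_def code_def)
  qed
  have GB: "G \<subseteq> carrier B"
    using eval_closed[where V = X and \<rho> = \<phi>, OF algB] \<phi> by (auto simp: G_def T_def)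
  have G_closed: "interp B f as \<in> G" if f: "sg f = Some (length as)" and as: "set as \<subseteq> G" for f as
  proof -
    have "\<forall>i<length as. \<exists>t\<in>T. as ! i = eval B \<phi> t"
      using as nth_mem[of _ as] unfolding G_def by fast
    then obtain g where g: "\<And>i. i < length as \<Longrightarrow> g i \<in> T \<and> as ! i = eval B \<phi> (g i)" by metis
    let ?t = "App f (map g [0..<length as])"
    have "?t \<in> T" using f g by (auto simp: T_def)
    moreover have "map (eval B \<phi>) (map g [0..<length as]) = as"
      by (rule nth_equalityI) (auto simp: g)
    then have "eval B \<phi> ?t = interp B f as" by (simp only: eval.simps)
    ultimately show ?thesis unfolding G_def by (metis image_eqI)
  qed
  define C :: "('f, ('f, 'a) trm set) ualg" where
    "C = \<lparr>carrier = code ` G, interp = (\<lambda>f Ss. code (interp B f (map dec Ss)))\<rparr>"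
  have carC: "carrier C = code ` G" and intC: "interp C f Ss = code (interp B f (map dec Ss))" for f Ss
    by (simp_all add: C_def)
  have dec_G: "dec S \<in> G" if "S \<in> carrier C" for S
    using that dec_code by (auto simp: carC)
  have code_dec: "code (dec S) = S" if "S \<in> carrier C" for S
    using that dec_code by (auto simp: carC)
  have dec_args: "set (map dec Ss) \<subseteq> G" if "set Ss \<subseteq> carrier C" for Ss
    using that dec_G by auto
  have algC: "algebra sg C"
    unfolding algebra_def subuniverse_def
  proof (intro conjI allI impI; (elim conjE)?)
    fix f Ss assume f: "sg f = Some (length Ss)" and Ss: "set Ss \<subseteq> carrier C"
    have "interp B f (map dec Ss) \<in> G"
      using G_closed[of f "map dec Ss"] dec_args[OF Ss] f by simp
    then show "interp C f Ss \<in> carrier C" by (simp add: carC intC)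
  qed simp
  have dec_hom: "dec (interp C f Ss) = interp B f (map dec Ss)"
    if "sg f = Some (length Ss)" "set Ss \<subseteq> carrier C" for f Ss
    using G_closed[of f "map dec Ss"] dec_args[OF that(2)] that(1) by (simp add: intC dec_code)
  have "in_variety sg E C"
    unfolding in_variety_def
  proof (intro conjI algC ballI, clarify)
    fix p q and \<rho> :: "nat \<Rightarrow> ('f, 'a) trm set" assume pq: "(p, q) \<in> E" and \<rho>: "range \<rho> \<subseteq> carrier C"
    have wf: "wf_trm sg UNIV p" "wf_trm sg UNIV q" using wfE pq by (auto simp: wf_identities_def)
    have \<rho>': "\<rho> v \<in> carrier C" for v using \<rho> by auto
    have "range (dec \<circ> \<rho>) \<subseteq> carrier B" using dec_G \<rho>' GB by fastforce
    then have "eval B (dec \<circ> \<rho>) p = eval B (dec \<circ> \<rho>) q"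
      using B pq unfolding in_variety_def by fast
    then have "dec (eval C \<rho> p) = dec (eval C \<rho> q)"
      using eval_hom[where h = dec and B = B and \<rho> = \<rho>, OF algC wf(1) \<rho>' dec_hom]
        eval_hom[where h = dec and B = B and \<rho> = \<rho>, OF algC wf(2) \<rho>' dec_hom] by simp
    moreover have "eval C \<rho> p \<in> carrier C" "eval C \<rho> q \<in> carrier C"
      by (rule eval_closed[OF algC wf(1)] eval_closed[OF algC wf(2)], rule \<rho>')+
    ultimately show "eval C \<rho> p = eval C \<rho> q" by (metis code_dec)
  qed
  then have "\<forall>\<psi> \<in> X \<rightarrow> carrier C. \<exists>h \<in> alg_hom sg A C. \<forall>x\<in>X. h x = \<psi> x"
    using free unfolding free_algebra_def by blast
  moreover have \<phi>G: "\<phi> x \<in> G" if "x \<in> X" for x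
    unfolding G_def by (rule image_eqI[of _ _ "Var x"]) (simp_all add: T_def that)
  then have "(\<lambda>x. code (\<phi> x)) \<in> X \<rightarrow> carrier C" by (auto simp: carC)
  ultimately obtain h where h: "h \<in> alg_hom sg A C" "\<forall>x\<in>X. h x = code (\<phi> x)"
    by (auto dest: bspec)
  have algA: "algebra sg A" and XA: "X \<subseteq> carrier A"
    using free by (auto simp: free_algebra_def in_variety_def generates_def)
  have hC: "h a \<in> carrier C" if "a \<in> carrier A" for a
    using h(1) that by (auto simp: alg_hom_def)
  define k where "k = restrict (dec \<circ> h) (carrier A)"
  have "k \<in> alg_hom sg A B"
    unfolding alg_hom_def
  proof (intro CollectI conjI allI impI; (elim conjE)?)
    show "k \<in> carrier A \<rightarrow>\<^sub>E carrier B" using hC dec_G GB by (auto simp: k_def)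
    fix f as assume f: "sg f = Some (length as)" and as: "set as \<subseteq> carrier A"
    have inA: "interp A f as \<in> carrier A" using algA f as by (simp add: algebra_def subuniverse_def)
    have "h (interp A f as) = interp C f (map h as)" using h(1) f as by (simp add: alg_hom_def)
    moreover have "dec (interp C f (map h as)) = interp B f (map dec (map h as))"
      using f as hC by (intro dec_hom) auto
    moreover have "map dec (map h as) = map k as" using as by (auto simp: k_def)
    moreover have "k (interp A f as) = dec (h (interp A f as))" using inA by (simp add: k_def)
    ultimately show "k (interp A f as) = interp B f (map k as)" by (simp only:)
  qed
  moreover have "\<forall>x\<in>X. k x = \<phi> x" using h(2) XA dec_code \<phi>G by (auto simp: k_def)
  ultimately show ?thesis by blast
qed


section \<open>The endomorphism semigroup and its automorphisms\<close>

definition End :: "'f signature \<Rightarrow> ('f, 'a) ualg \<Rightarrow> ('a \<Rightarrow> 'a) monoid" where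
  "End sg A = \<lparr>carrier = alg_hom sg A A, mult = compose (carrier A), one = (\<lambda>a\<in>carrier A. a)\<rparr>"

definition quasi_inner ::
    "'f signature \<Rightarrow> ('f, 'a) ualg \<Rightarrow> (('a \<Rightarrow> 'a) \<Rightarrow> ('a \<Rightarrow> 'a)) \<Rightarrow> bool" where
  "quasi_inner sg A \<Phi> \<longleftrightarrow> \<Phi> \<in> iso (End sg A) (End sg A) \<and>
     (\<exists>t. bij_betw t (carrier A) (carrier A) \<and>
        (\<forall>\<nu> \<in> carrier (End sg A).
           \<Phi> \<nu> = compose (carrier A) t (compose (carrier A) \<nu> (inv_into (carrier A) t))))"

definition perm_auts :: "'f signature \<Rightarrow> ('f, 'a) ualg \<Rightarrow> 'a set \<Rightarrow> ('a \<Rightarrow> 'a) set" where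
  "perm_auts sg A X =
     {\<gamma> \<in> carrier (End sg A). bij_betw \<gamma> (carrier A) (carrier A) \<and> \<gamma> ` X = X}"

definition const_endo :: "'f signature \<Rightarrow> ('f, 'a) ualg \<Rightarrow> 'a set \<Rightarrow> 'a \<Rightarrow> 'a \<Rightarrow> 'a" where
  "const_endo sg A X a = (THE \<nu>. \<nu> \<in> carrier (End sg A) \<and> (\<forall>x\<in>X. \<nu> x = a))"

text \<open>The main permutation sends \<open>a\<close> to the common value on \<open>X\<close> of the image of
  the constant endomorphism at \<open>a\<close>. It is meaningful for nonempty \<open>X\<close> and \<open>\<Phi>\<close> preserving
  \<^const>\<open>perm_auts\<close>.\<close>

definition main_perm ::
    "'f signature \<Rightarrow> ('f, 'a) ualg \<Rightarrow> 'a set \<Rightarrow> (('a \<Rightarrow> 'a) \<Rightarrow> ('a \<Rightarrow> 'a)) \<Rightarrow> 'a \<Rightarrow> 'a" where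
  "main_perm sg A X \<Phi> a = (THE b. \<forall>x\<in>X. \<Phi> (const_endo sg A X a) x = b)"


section \<open>Polynomial and derived operations\<close>

text \<open>A \<open>k\<close>-ary operation is a function on lists, considered on lists of length \<open>k\<close> over the
  carrier only.\<close>

definition polynomial_operation ::
    "'f signature \<Rightarrow> ('f, 'a) ualg \<Rightarrow> nat \<Rightarrow> ('a list \<Rightarrow> 'a) \<Rightarrow> bool" where
  "polynomial_operation sg A k \<omega> \<longleftrightarrow>
     (\<exists>p. wf_trm sg {..<k} p \<and>
        (\<forall>as. length as = k \<and> set as \<subseteq> carrier A \<longrightarrow> \<omega> as = eval A (\<lambda>i. as ! i) p))"

text \<open>The free generators are listed as \<open>xs\<close>.\<close>

definition subst_endo ::
    "'f signature \<Rightarrow> ('f, 'a) ualg \<Rightarrow> 'a list \<Rightarrow> 'a list \<Rightarrow> 'a \<Rightarrow> 'a" where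
  "subst_endo sg A xs as =
     (THE \<alpha>. \<alpha> \<in> carrier (End sg A) \<and> (\<forall>i<length xs. \<alpha> (xs ! i) = as ! i))"

definition derived_operation ::
    "'f signature \<Rightarrow> ('f, 'a) ualg \<Rightarrow> 'a list \<Rightarrow> ('a \<Rightarrow> 'a) \<Rightarrow> nat \<Rightarrow> ('a list \<Rightarrow> 'a) \<Rightarrow> 'a list \<Rightarrow> 'a"
  where
  "derived_operation sg A xs s k \<omega> as =
     subst_endo sg A xs (as @ drop k xs) (s (\<omega> (take k xs)))"

end

theory Submission
  imports Defs
begin

text \<open>
  Write \<open>\<nu>\<^sub>a\<close> for the endomorphism that is constantly \<open>a\<close> on the basis \<open>X\<close>. An endomorphism of
  the form \<open>\<nu>\<^sub>a\<close> is recognised inside the semigroup: it is one that absorbs on its right every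
  automorphism permuting \<open>X\<close>, because transpositions act transitively on \<open>X\<close>. An automorphism
  \<open>\<Phi>\<close> of the semigroup that preserves these permutations therefore maps the set of all \<open>\<nu>\<^sub>a\<close>
  onto itself (\<open>Phi_const_endo\<close>, \<open>main_perm_bij\<close>), and the main permutation \<open>s\<close> is the bijection
  of the carrier given by \<open>\<Phi> \<nu>\<^sub>a = \<nu>\<^bsub>s a\<^esub>\<close>. Since \<open>\<mu> \<nu>\<^sub>a = \<nu>\<^bsub>\<mu> a\<^esub>\<close>, applying \<open>\<Phi>\<close> gives
  \<open>\<Phi> \<mu> \<circ> s = s \<circ> \<mu>\<close> for every endomorphism \<open>\<mu>\<close> (\<open>Phi_main_perm\<close>).

  The theorem follows by moving from arbitrary arguments to the generators and back. Let \<open>\<beta>\<close>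
  send the first \<open>k\<close> generators to \<open>as\<close> and fix the others. Then \<open>\<omega> as = \<beta> (\<omega> (x\<^sub>1, \<dots>, x\<^sub>k))\<close>, so
  \<open>s (\<omega> as) = \<Phi> \<beta> (s (\<omega> (x\<^sub>1, \<dots>, x\<^sub>k)))\<close>. As \<open>s\<close> fixes the generators, the intertwining relation
  computes \<open>\<Phi> \<beta>\<close> on them: it sends the first \<open>k\<close> to \<open>map s as\<close> and fixes the others. Thus
  \<open>\<Phi> \<beta>\<close> is the substitution by which the derived operation is evaluated at \<open>map s as\<close>.
\<close>

section \<open>Homomorphisms\<close>

lemma alg_hom_closed: "h \<in> alg_hom sg A B \<Longrightarrow> a \<in> carrier A \<Longrightarrow> h a \<in> carrier B"
  by (auto simp: alg_hom_def)

lemma alg_hom_interp: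
  "h \<in> alg_hom sg A B \<Longrightarrow> sg f = Some (length as) \<Longrightarrow> set as \<subseteq> carrier A \<Longrightarrow>
     h (interp A f as) = interp B f (map h as)"
  by (auto simp: alg_hom_def)

text \<open>Two homomorphisms agree on a subuniverse, so agreement on generators spreads to the
  carrier.\<close>

lemma alg_hom_eqI:
  assumes algA: "algebra sg A" and gen: "generates sg A X"
    and g: "g \<in> alg_hom sg A B" and h: "h \<in> alg_hom sg A B"
    and eq: "\<And>x. x \<in> X \<Longrightarrow> g x = h x"
  shows "g = h"
proof -
  let ?S = "{a \<in> carrier A. g a = h a}"
  have "subuniverse sg A ?S"
    unfolding subuniverse_def
  proof (intro conjI allI impI; (elim conjE)?)
    fix f as assume f: "sg f = Some (length as)" and as: "set as \<subseteq> ?S"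
    have sub: "set as \<subseteq> carrier A" using as by blast
    have "map g as = map h as" using as by auto
    then have "g (interp A f as) = h (interp A f as)"
      by (simp only: alg_hom_interp[OF g f sub] alg_hom_interp[OF h f sub])
    moreover have "interp A f as \<in> carrier A"
      using algA f sub by (simp add: algebra_def subuniverse_def)
    ultimately show "interp A f as \<in> ?S" by simp
  qed simp
  moreover have "X \<subseteq> ?S" using gen eq by (auto simp: generates_def)
  ultimately have "?S = carrier A" using gen unfolding generates_def by blast
  then have "g a = h a" if "a \<in> carrier A" for a using that by blast
  moreover have "g \<in> extensional (carrier A)" "h \<in> extensional (carrier A)"
    using g h by (auto simp: alg_hom_def PiE_def)
  ultimately show ?thesis by (intro extensionalityI)
qed

lemma alg_hom_compose:
  assumes algA: "algebra sg A" and g: "g \<in> alg_hom sg B C" and h: "h \<in> alg_hom sg A B"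
  shows "compose (carrier A) g h \<in> alg_hom sg A C"
  unfolding alg_hom_def
proof (intro CollectI conjI allI impI; (elim conjE)?)
  show "compose (carrier A) g h \<in> carrier A \<rightarrow>\<^sub>E carrier C"
    using alg_hom_closed[OF g] alg_hom_closed[OF h] by (auto simp: compose_def)
  fix f as assume f: "sg f = Some (length as)" and as: "set as \<subseteq> carrier A"
  have "interp A f as \<in> carrier A" using algA f as by (simp add: algebra_def subuniverse_def)
  then have "compose (carrier A) g h (interp A f as) = g (interp B f (map h as))"
    by (simp add: compose_eq alg_hom_interp[OF h f as])
  also have "\<dots> = interp C f (map g (map h as))"
    using f as alg_hom_closed[OF h] by (intro alg_hom_interp[OF g]) auto
  also have "map g (map h as) = map (compose (carrier A) g h) as"
    using as by (auto simp: compose_eq)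
  finally show "compose (carrier A) g h (interp A f as)
      = interp C f (map (compose (carrier A) g h) as)" .
qed

section \<open>Endomorphisms of a free algebra\<close>

locale free_on =
  fixes sg :: "'f signature" and E :: "'f identities"
    and F :: "('f, 'a) ualg" and X :: "'a set"
  assumes wf_identities: "wf_identities sg E" and free: "free_algebra sg E F X"
begin

abbreviation "endo \<equiv> alg_hom sg F F"

lemma in_variety: "in_variety sg E F"
  using free by (simp only: free_algebra_def)

lemma generates: "generates sg F X"
  using free by (simp only: free_algebra_def)

lemma algebra: "algebra sg F"
  using in_variety by (simp only: in_variety_def)

lemma X_subset: "X \<subseteq> carrier F"
  using generates by (simp only: generates_def)

lemmas endo_eqI = alg_hom_eqI[OF algebra generates, where B = F]
lemmas endo_compose = alg_hom_compose[OF algebra, where B = F and C = F]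

lemma ex1_endo:
  assumes "\<phi> \<in> X \<rightarrow> carrier F"
  shows "\<exists>!h. h \<in> endo \<and> (\<forall>x\<in>X. h x = \<phi> x)"
proof (rule ex_ex1I)
  show "\<exists>h. h \<in> endo \<and> (\<forall>x\<in>X. h x = \<phi> x)"
    using free_algebra_extension[OF free wf_identities in_variety assms] by blast
  fix g h assume "g \<in> endo \<and> (\<forall>x\<in>X. g x = \<phi> x)" and "h \<in> endo \<and> (\<forall>x\<in>X. h x = \<phi> x)"
  then show "g = h" by (metis endo_eqI)
qed

lemma const_endo:
  assumes "a \<in> carrier F"
  shows "const_endo sg F X a \<in> endo" and "\<And>x. x \<in> X \<Longrightarrow> const_endo sg F X a x = a"
proof -
  have "(\<lambda>_. a) \<in> X \<rightarrow> carrier F" using assms by simp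
  from theI'[OF ex1_endo[OF this]]
  have "const_endo sg F X a \<in> endo \<and> (\<forall>x\<in>X. const_endo sg F X a x = a)"
    by (simp add: const_endo_def End_def)
  then show "const_endo sg F X a \<in> endo" and "\<And>x. x \<in> X \<Longrightarrow> const_endo sg F X a x = a"
    by blast+
qed

lemma endo_eq_const_endoI:
  assumes "h \<in> endo" "a \<in> carrier F" "\<And>x. x \<in> X \<Longrightarrow> h x = a"
  shows "h = const_endo sg F X a"
  by (rule endo_eqI) (simp_all add: assms const_endo)

lemma subst_endo_eqI:
  assumes X: "X = set xs" and h: "h \<in> endo" and eq: "\<And>i. i < length xs \<Longrightarrow> h (xs ! i) = as ! i"
  shows "subst_endo sg F xs as = h"
  unfolding subst_endo_def
proof (rule the_equality)
  fix g assume "g \<in> carrier (End sg F) \<and> (\<forall>i<length xs. g (xs ! i) = as ! i)"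
  then have g: "g \<in> endo" "\<And>i. i < length xs \<Longrightarrow> g (xs ! i) = as ! i" by (simp_all add: End_def)
  show "g = h"
  proof (rule endo_eqI[OF g(1) h])
    fix x assume "x \<in> X"
    then show "g x = h x" unfolding X in_set_conv_nth using g(2) eq by metis
  qed
qed (use h eq in \<open>simp add: End_def\<close>)

text \<open>The transposition of two generators extends to an endomorphism whose square is the identity
  on \<open>X\<close>, hence everywhere; so it is an automorphism.\<close>

lemma perm_auts_transitive:
  assumes x: "x \<in> X" and y: "y \<in> X"
  obtains \<gamma> where "\<gamma> \<in> perm_auts sg F X" "\<gamma> x = y"
proof -
  let ?\<tau> = "\<lambda>z. if z = x then y else if z = y then x else z"
  have "?\<tau> \<in> X \<rightarrow> carrier F" using X_subset x y by auto
  from ex1_implies_ex[OF ex1_endo[OF this]]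
  obtain \<gamma> where \<gamma>: "\<gamma> \<in> endo" and \<gamma>_X: "\<And>z. z \<in> X \<Longrightarrow> \<gamma> z = ?\<tau> z" by blast
  have id: "(\<lambda>a\<in>carrier F. a) \<in> endo"
    using algebra by (auto simp: alg_hom_def algebra_def subuniverse_def subset_iff map_idI)
  have "compose (carrier F) \<gamma> \<gamma> = (\<lambda>a\<in>carrier F. a)"
    using X_subset x y by (intro endo_eqI endo_compose \<gamma> id) (auto simp: compose_eq \<gamma>_X)
  then have "\<gamma> (\<gamma> a) = a" if "a \<in> carrier F" for a
    using that by (metis compose_eq restrict_apply')
  then have "bij_betw \<gamma> (carrier F) (carrier F)"
    using alg_hom_closed[OF \<gamma>] by (intro bij_betw_byWitness[where f' = \<gamma>]) auto
  moreover have "\<gamma> ` X = ?\<tau> ` X" using \<gamma>_X by (intro image_cong) auto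
  then have "\<gamma> ` X = X" using x y by (auto simp: image_iff)
  ultimately show thesis using \<gamma> \<gamma>_X x by (intro that[of \<gamma>]) (auto simp: perm_auts_def End_def)
qed

lemma perm_auts_endo: "\<gamma> \<in> perm_auts sg F X \<Longrightarrow> \<gamma> \<in> endo"
  by (simp add: perm_auts_def End_def)

text \<open>The next two lemmas are converse to each other. Together they describe constancy on \<open>X\<close> by
  products in the semigroup, which is the form that an automorphism of the semigroup respects.\<close>

lemma const_endo_absorbs_perm_auts:
  assumes "a \<in> carrier F" "\<gamma> \<in> perm_auts sg F X"
  shows "compose (carrier F) (const_endo sg F X a) \<gamma> = const_endo sg F X a"
proof (rule endo_eq_const_endoI)
  show "compose (carrier F) (const_endo sg F X a) \<gamma> \<in> endo"
    using assms by (intro endo_compose const_endo perm_auts_endo)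
  fix x assume "x \<in> X"
  then have "x \<in> carrier F" "\<gamma> x \<in> X" using X_subset assms(2) by (auto simp: perm_auts_def)
  then show "compose (carrier F) (const_endo sg F X a) \<gamma> x = a"
    using assms(1) by (simp add: compose_eq const_endo)
qed (use assms in simp)

lemma constant_if_absorbs_perm_auts:
  assumes absorb: "\<And>\<gamma>. \<gamma> \<in> perm_auts sg F X \<Longrightarrow> compose (carrier F) \<mu> \<gamma> = \<mu>"
    and x: "x \<in> X" and y: "y \<in> X"
  shows "\<mu> x = \<mu> y"
proof -
  obtain \<gamma> where \<gamma>: "\<gamma> \<in> perm_auts sg F X" "\<gamma> x = y"
    using perm_auts_transitive[OF x y] .
  have "\<mu> x = compose (carrier F) \<mu> \<gamma> x" by (simp add: absorb[OF \<gamma>(1)])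
  also have "\<dots> = \<mu> y" using X_subset x by (auto simp: compose_eq \<gamma>(2))
  finally show ?thesis .
qed

end

section \<open>The main permutation\<close>

locale perm_preserving_automorphism = free_on sg E F X
  for sg :: "'f signature" and E and F :: "('f, 'a) ualg" and X +
  fixes \<Phi> :: "('a \<Rightarrow> 'a) \<Rightarrow> 'a \<Rightarrow> 'a"
  assumes Phi_iso: "\<Phi> \<in> iso (End sg F) (End sg F)"
    and Phi_perm_auts: "\<Phi> ` perm_auts sg F X = perm_auts sg F X"
    and X_nonempty: "X \<noteq> {}"
begin

abbreviation "s \<equiv> main_perm sg F X \<Phi>"

lemma Phi_bij: "bij_betw \<Phi> endo endo"
  and Phi_compose: "\<And>g h. g \<in> endo \<Longrightarrow> h \<in> endo \<Longrightarrow>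
    \<Phi> (compose (carrier F) g h) = compose (carrier F) (\<Phi> g) (\<Phi> h)"
  using Phi_iso by (auto simp: iso_def hom_def End_def)

lemma Phi_closed: "g \<in> endo \<Longrightarrow> \<Phi> g \<in> endo"
  using Phi_bij by (auto simp: bij_betw_def)

text \<open>The image of a constant endomorphism still absorbs the permutations of \<open>X\<close>, so it is constant
  on \<open>X\<close>; this is what makes the description defining the main permutation meaningful.\<close>

lemma Phi_const_endo:
  assumes a: "a \<in> carrier F"
  shows "s a \<in> carrier F" and "\<Phi> (const_endo sg F X a) = const_endo sg F X (s a)"
proof -
  let ?\<nu> = "const_endo sg F X a"
  have \<nu>: "\<Phi> ?\<nu> \<in> endo" by (rule Phi_closed[OF const_endo(1)[OF a]])
  have absorb: "compose (carrier F) (\<Phi> ?\<nu>) \<gamma>' = \<Phi> ?\<nu>" if \<gamma>': "\<gamma>' \<in> perm_auts sg F X" for \<gamma>'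
  proof -
    obtain \<gamma> where \<gamma>: "\<gamma> \<in> perm_auts sg F X" "\<gamma>' = \<Phi> \<gamma>" using \<gamma>' Phi_perm_auts by blast
    have "compose (carrier F) (\<Phi> ?\<nu>) \<gamma>' = \<Phi> (compose (carrier F) ?\<nu> \<gamma>)"
      by (simp add: \<gamma>(2) Phi_compose const_endo(1)[OF a] perm_auts_endo[OF \<gamma>(1)])
    then show ?thesis by (simp add: const_endo_absorbs_perm_auts[OF a \<gamma>(1)])
  qed
  obtain x where x: "x \<in> X" using X_nonempty by blast
  have const: "\<Phi> ?\<nu> y = \<Phi> ?\<nu> x" if "y \<in> X" for y
    using constant_if_absorbs_perm_auts[OF absorb that x] .
  have s_a: "s a = \<Phi> ?\<nu> x"
    unfolding main_perm_def by (rule the_equality) (use const x in \<open>blast, metis\<close>)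
  show s_closed: "s a \<in> carrier F" using s_a alg_hom_closed[OF \<nu>] x X_subset by auto
  show "\<Phi> ?\<nu> = const_endo sg F X (s a)"
    unfolding s_a by (intro endo_eq_const_endoI \<nu> const) (use s_closed s_a in simp)
qed

text \<open>Apply \<open>\<Phi>\<close> to \<open>\<mu> \<nu>\<^sub>a = \<nu>\<^bsub>\<mu> a\<^esub>\<close> and evaluate at a generator.\<close>

lemma Phi_main_perm:
  assumes \<mu>: "\<mu> \<in> endo" and a: "a \<in> carrier F"
  shows "\<Phi> \<mu> (s a) = s (\<mu> a)"
proof -
  obtain x where x: "x \<in> X" "x \<in> carrier F" using X_nonempty X_subset by blast
  have \<mu>a: "\<mu> a \<in> carrier F" using alg_hom_closed[OF \<mu> a] .
  have "compose (carrier F) \<mu> (const_endo sg F X a) = const_endo sg F X (\<mu> a)"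
  proof (rule endo_eq_const_endoI[OF endo_compose[OF \<mu> const_endo(1)[OF a]] \<mu>a])
    fix y assume y: "y \<in> X"
    then have "y \<in> carrier F" using X_subset by blast
    then show "compose (carrier F) \<mu> (const_endo sg F X a) y = \<mu> a"
      by (simp only: compose_eq const_endo(2)[OF a y])
  qed
  then have "const_endo sg F X (s (\<mu> a)) = compose (carrier F) (\<Phi> \<mu>) (const_endo sg F X (s a))"
    using Phi_compose[OF \<mu> const_endo(1)[OF a]] by (simp add: Phi_const_endo(2) \<mu>a a)
  then have "const_endo sg F X (s (\<mu> a)) x = \<Phi> \<mu> (const_endo sg F X (s a) x)"
    using x by (simp add: compose_eq)
  then show ?thesis using x a \<mu>a by (simp add: const_endo(2) Phi_const_endo(1))
qed

text \<open>Injectivity is that of \<open>\<Phi>\<close>. For surjectivity, the endomorphism \<open>\<mu>\<close> with \<open>\<Phi> \<mu> = \<nu>\<^sub>b\<close> must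
  itself be constant on \<open>X\<close>, because \<open>\<Phi>\<close> reflects the absorption property.\<close>

lemma main_perm_bij: "bij_betw s (carrier F) (carrier F)"
proof -
  obtain x where x: "x \<in> X" "x \<in> carrier F" using X_nonempty X_subset by blast
  have inj: "inj_on \<Phi> endo" using Phi_bij by (simp add: bij_betw_def)
  have "inj_on s (carrier F)"
  proof (rule inj_onI)
    fix a b assume a: "a \<in> carrier F" and b: "b \<in> carrier F" and "s a = s b"
    then have "\<Phi> (const_endo sg F X a) = \<Phi> (const_endo sg F X b)"
      by (simp add: Phi_const_endo(2))
    then have "const_endo sg F X a = const_endo sg F X b"
      using inj_onD[OF inj] const_endo(1) a b by blast
    then show "a = b" using const_endo(2)[OF _ x(1)] a b by metis
  qed
  moreover have "\<exists>a\<in>carrier F. s a = b" if b: "b \<in> carrier F" for b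
  proof -
    obtain \<mu> where \<mu>: "\<mu> \<in> endo" and Phi_\<mu>: "\<Phi> \<mu> = const_endo sg F X b"
      using Phi_bij const_endo(1)[OF b] by (metis bij_betw_def imageE)
    have "compose (carrier F) \<mu> \<gamma> = \<mu>" if \<gamma>: "\<gamma> \<in> perm_auts sg F X" for \<gamma>
    proof (rule inj_onD[OF inj _ endo_compose[OF \<mu> perm_auts_endo[OF \<gamma>]] \<mu>])
      have "\<Phi> \<gamma> \<in> perm_auts sg F X" using \<gamma> Phi_perm_auts by blast
      then show "\<Phi> (compose (carrier F) \<mu> \<gamma>) = \<Phi> \<mu>"
        by (simp add: Phi_compose[OF \<mu> perm_auts_endo[OF \<gamma>]] Phi_\<mu>
            const_endo_absorbs_perm_auts[OF b])
    qed
    then have const: "\<mu> y = \<mu> x" if "y \<in> X" for y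
      using constant_if_absorbs_perm_auts that x(1) by blast
    have \<mu>x: "\<mu> x \<in> carrier F" using alg_hom_closed[OF \<mu> x(2)] .
    have "\<mu> = const_endo sg F X (\<mu> x)"
      by (intro endo_eq_const_endoI \<mu> \<mu>x const)
    then have "const_endo sg F X (s (\<mu> x)) = const_endo sg F X b"
      using Phi_\<mu> Phi_const_endo(2)[OF \<mu>x] by simp
    then have "s (\<mu> x) = b"
      using const_endo(2)[OF _ x(1)] b Phi_const_endo(1)[OF \<mu>x] by metis
    then show ?thesis using \<mu>x by blast
  qed
  ultimately show ?thesis
    using Phi_const_endo(1) unfolding bij_betw_def by blast
qed

end

section \<open>Derived operations\<close>

lemma polynomial_operation_hom:
  assumes \<omega>: "polynomial_operation sg A k \<omega>" and algA: "algebra sg A"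
    and h: "h \<in> alg_hom sg A A" and as: "length as = k" "set as \<subseteq> carrier A"
  shows "\<omega> as \<in> carrier A" and "\<omega> (map h as) = h (\<omega> as)"
proof -
  obtain p where p: "wf_trm sg {..<k} p"
    and \<omega>_p: "\<And>as. length as = k \<Longrightarrow> set as \<subseteq> carrier A \<Longrightarrow> \<omega> as = eval A (\<lambda>i. as ! i) p"
    using \<omega> unfolding polynomial_operation_def by blast
  have as_nth: "as ! i \<in> carrier A" if "i \<in> {..<k}" for i
    using as that by auto
  show "\<omega> as \<in> carrier A" using eval_closed[OF algA p as_nth] as by (simp add: \<omega>_p)
  \<comment> \<open>Beyond position \<open>k\<close>, \<open>map h as ! i\<close> and \<open>h (as ! i)\<close> are unrelated defaults, so the two
    assignments are compared on the variables of \<open>p\<close> only.\<close>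
  have eval_cong: "eval A \<rho> t = eval A \<rho>' t"
    if "wf_trm sg {..<k} t" "\<And>i. i < k \<Longrightarrow> \<rho> i = \<rho>' i" for \<rho> \<rho>' and t
    using that
  proof (induction t)
    case (App f ts)
    then have "map (eval A \<rho>) ts = map (eval A \<rho>') ts" by auto
    then show ?case by (simp only: eval.simps)
  qed auto
  have "h (\<omega> as) = eval A (h \<circ> (!) as) p"
    unfolding \<omega>_p[OF as] by (rule eval_hom[OF algA p as_nth alg_hom_interp[OF h]])
  also have "\<dots> = eval A ((!) (map h as)) p"
    using as by (intro eval_cong p) auto
  also have "\<dots> = \<omega> (map h as)"
    using as alg_hom_closed[OF h] by (subst \<omega>_p) auto
  finally show "\<omega> (map h as) = h (\<omega> as)" ..
qed

theorem theorem6: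
  fixes sg :: "'f signature" and E :: "'f identities"
    and F :: "('f, 'a) ualg" and xs :: "'a list" and n k :: nat
    and \<Phi> :: "('a \<Rightarrow> 'a) \<Rightarrow> ('a \<Rightarrow> 'a)" and s :: "'a \<Rightarrow> 'a" and \<omega> :: "'a list \<Rightarrow> 'a"
  assumes "wf_identities sg E"
    and "distinct xs" and "length xs = n" and "n \<ge> 1"
    and "free_algebra sg E F (set xs)"
    and "quasi_inner sg F \<Phi>"
    and "\<forall>\<gamma> \<in> perm_auts sg F (set xs). \<Phi> \<gamma> = \<gamma>"
    and "s = main_perm sg F (set xs) \<Phi>"
    and "\<forall>x \<in> set xs. s x = x"
    and "polynomial_operation sg F k \<omega>" and "k \<le> n"
  shows "bij_betw s (carrier F) (carrier F) \<and>
    (\<forall>as. length as = k \<and> set as \<subseteq> carrier F \<longrightarrow>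
       s (\<omega> as) = derived_operation sg F xs s k \<omega> (map s as))"
proof -
  interpret perm_preserving_automorphism sg E F "set xs" \<Phi>
    using assms by unfold_locales (auto simp: quasi_inner_def)
  have s: "s = main_perm sg F (set xs) \<Phi>" by fact
  have "s (\<omega> as) = derived_operation sg F xs s k \<omega> (map s as)"
    if as: "length as = k" "set as \<subseteq> carrier F" for as
  proof -
    define bs where "bs = as @ drop k xs"
    have len: "length bs = length xs" using as assms by (simp add: bs_def)
    have bs: "set bs \<subseteq> carrier F" using as X_subset by (auto simp: bs_def dest: in_set_dropD)
    have "(\<lambda>x. the (map_of (zip xs bs) x)) \<in> set xs \<rightarrow> carrier F"
    proof
      fix x assume "x \<in> set xs"
      then obtain i where "i < length xs" "x = xs ! i" by (metis in_set_conv_nth)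
      then show "the (map_of (zip xs bs) x) \<in> carrier F"
        using bs len \<open>distinct xs\<close> nth_mem[of i bs] by (auto simp: map_of_zip_nth)
    qed
    from ex1_implies_ex[OF ex1_endo[OF this]]
    obtain \<beta> where \<beta>: "\<beta> \<in> endo"
      and \<beta>_map: "\<And>x. x \<in> set xs \<Longrightarrow> \<beta> x = the (map_of (zip xs bs) x)" by blast
    have \<beta>_xs: "\<beta> (xs ! i) = bs ! i" if "i < length xs" for i
      using that len \<open>distinct xs\<close> by (simp add: \<beta>_map map_of_zip_nth)
    have gens: "length (take k xs) = k" "set (take k xs) \<subseteq> carrier F"
      using assms X_subset by (auto dest: in_set_takeD)
    have "map \<beta> (take k xs) = as"
      using as gens \<beta>_xs by (intro nth_equalityI) (auto simp: bs_def nth_append)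
    then have \<omega>_as: "\<omega> as = \<beta> (\<omega> (take k xs))"
      using polynomial_operation_hom(2)[OF assms(10) algebra \<beta> gens] by simp
    have "subst_endo sg F xs (map s as @ drop k xs) = \<Phi> \<beta>"
    proof (rule subst_endo_eqI[OF refl Phi_closed[OF \<beta>]])
      fix i assume i: "i < length xs"
      have "\<Phi> \<beta> (xs ! i) = \<Phi> \<beta> (s (xs ! i))" using assms(9) i by simp
      also have "\<dots> = s (\<beta> (xs ! i))"
        unfolding s using X_subset i by (intro Phi_main_perm[OF \<beta>]) auto
      also have "\<dots> = s (bs ! i)" by (simp add: \<beta>_xs i)
      also have "\<dots> = (map s as @ drop k xs) ! i"
        using assms(9) i as by (auto simp: bs_def nth_append)
      finally show "\<Phi> \<beta> (xs ! i) = (map s as @ drop k xs) ! i" .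
    qed
    moreover have "s (\<omega> as) = \<Phi> \<beta> (s (\<omega> (take k xs)))"
      unfolding s \<omega>_as
      by (intro Phi_main_perm[symmetric] \<beta>
          polynomial_operation_hom(1)[OF assms(10) algebra \<beta> gens])
    ultimately show ?thesis by (simp only: derived_operation_def)
  qed
  then show ?thesis using main_perm_bij s by simp
qed

end
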